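(* Let $Y$ be a random variable whose moment generating function $E[e^{tY}]=\sum_{n=0}^{\infty}E[Y^n]\frac{t^n}{n!}$ exists for $|t|<r$, for some $r>0$. Let $(Y_j)_{j\ge1}$ be mutually independent copies of $Y$, and put $S_0=0$, $S_k=Y_1+\cdots+Y_k$ for $k\ge1$. Define the numbers $T^{Y}(n,k)$ by $$\frac{1}{k!}\Big(E\big[e^{\frac{Y}{2}t}\big]-E\big[e^{-\frac{Y}{2}t}\big]\Big)^{k}=\sum_{n=k}^{\infty}T^{Y}(n,k)\frac{t^{n}}{n!},\quad (k\ge 0).$$ Then for all integers $n\ge k\ge 0$, $$2^{n}T^{Y}(n,k)= \frac{1}{k!}\sum_{j=0}^{k}\sum_{l=0}^{n}\binom{n}{l}\binom{k}{j}(-1)^{n-l-j}E\big[S_{k-j}^{l}\big]E\big[S_{j}^{n-l}\big].$$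
   Context: $T^{Y}(n,k)$ are called the probabilistic central factorial numbers of the second kind associated with $Y$; the defining identity is an identity of power series in $t$. *)

theory Defs
  imports "HOL-Probability.Probability"
begin

text \<open>
  The defining identity of \<open>T\<^sup>Y(n,k)\<close> is read as an identity of power series about \<open>t = 0\<close>:
  the series on the right has a positive radius of convergence and represents the left-hand side
  near \<open>0\<close>. It mentions \<open>T\<^sup>Y(n,k)\<close> only for \<open>n \<ge> k\<close>; the remaining values are set to \<open>0\<close> by
  convention, so that the description is unique.
\<close>

definition prob_central_factorial :: "'a measure \<Rightarrow> ('a \<Rightarrow> real) \<Rightarrow> nat \<Rightarrow> nat \<Rightarrow> real" where
  "prob_central_factorial M Y = (THE T.
     (\<forall>k. (\<lambda>t. 1 / fact k *
             (integral\<^sup>L M (\<lambda>\<omega>. exp (Y \<omega> / 2 * t)) - integral\<^sup>L M (\<lambda>\<omega>. exp (- (Y \<omega> / 2) * t))) ^ k)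
          has_fps_expansion Abs_fps (\<lambda>n. if k \<le> n then T n k / fact n else 0)) \<and>
     (\<forall>n k. n < k \<longrightarrow> T n k = 0))"

definition partial_sum :: "(nat \<Rightarrow> 'a \<Rightarrow> real) \<Rightarrow> nat \<Rightarrow> 'a \<Rightarrow> real" where
  "partial_sum X k \<omega> = (\<Sum>j=1..k. X j \<omega>)"

end

theory Submission
  imports Defs
begin

text \<open>
  Near \<open>0\<close> the moment generating function of \<open>Y\<close> is represented by the exponential generating
  series \<open>P\<close> of its moments, and by independence the series of \<open>S\<^sub>j\<close> is \<open>P ^ j\<close>. The defining
  identity therefore says that \<open>T\<^sup>Y(n,k) / n!\<close> is the \<open>n\<close>-th coefficient of
  \<open>(P(t/2) - P(-t/2))\<^sup>k / k!\<close>; expanding this power binomially gives the formula.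
\<close>

definition moment_fps :: "'a measure \<Rightarrow> ('a \<Rightarrow> real) \<Rightarrow> real fps" where
  "moment_fps M Z = Abs_fps (\<lambda>n. integral\<^sup>L M (\<lambda>\<omega>. Z \<omega> ^ n) / fact n)"

section \<open>Uniqueness of power series expansions\<close>

lemma has_fps_expansion_zero_imp_eq_0:
  fixes F :: "'a :: {banach, real_normed_field} fps"
  assumes "(\<lambda>_. 0) has_fps_expansion F"
  shows "F = 0"
proof (rule ccontr)
  assume "F \<noteq> 0"
  define n where "n = subdegree F"
  define c where "c = fps_nth F n"
  have "c \<noteq> 0"
    using \<open>F \<noteq> 0\<close> by (simp add: c_def n_def)
  \<comment> \<open>Dividing by the lowest power of \<open>x\<close> gives a function with a jump at \<open>0\<close>.\<close>
  have "(\<lambda>x. if x = 0 then c else 0 / x ^ n) has_fps_expansion fps_shift n F"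
    by (rule has_fps_expansion_shift[OF assms]) (simp_all add: n_def c_def)
  then have "continuous (at 0) (\<lambda>x::'a. if x = 0 then c else 0 / x ^ n)"
    by (rule has_fps_expansion_imp_continuous)
  then have "((\<lambda>x::'a. if x = 0 then c else 0 / x ^ n) \<longlongrightarrow> c) (at 0)"
    by (simp add: continuous_at)
  moreover have "eventually (\<lambda>x::'a. (if x = 0 then c else 0 / x ^ n) = 0) (at 0)"
    by (auto simp: eventually_at_filter)
  ultimately have "((\<lambda>_::'a. 0) \<longlongrightarrow> c) (at 0)"
    using tendsto_cong by fastforce
  then show False
    using \<open>c \<noteq> 0\<close> by (simp add: tendsto_const_iff)
qed

text \<open>The difference of two expansions of \<open>f\<close> expands the zero function. This is
  what makes the definite description in \<open>prob_central_factorial\<close> unique.\<close>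

lemma has_fps_expansion_unique:
  fixes F G :: "'a :: {banach, real_normed_field} fps"
  assumes "f has_fps_expansion F" "f has_fps_expansion G"
  shows "F = G"
  using has_fps_expansion_zero_imp_eq_0[of "F - G"] has_fps_expansion_diff[OF assms] by simp

section \<open>Moments and the moment generating function\<close>

text \<open>A single term of the exponential series is at most its sum, so
  \<open>(t * |Z|) ^ n / fact n\<close> is bounded by \<open>exp (t * |Z|)\<close>, and hence by the
  sum of the two integrable exponentials.\<close>

lemma integrable_power_of_integrable_exp:
  fixes Z :: "'a \<Rightarrow> real"
  assumes [measurable]: "Z \<in> borel_measurable M" and "t > 0"
    and "integrable M (\<lambda>\<omega>. exp (t * Z \<omega>))" "integrable M (\<lambda>\<omega>. exp (- t * Z \<omega>))"
  shows "integrable M (\<lambda>\<omega>. Z \<omega> ^ n)"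
proof (rule Bochner_Integration.integrable_bound)
  show "integrable M (\<lambda>\<omega>. fact n / t ^ n * (exp (t * Z \<omega>) + exp (- t * Z \<omega>)))"
    using assms by (intro integrable_mult_right Bochner_Integration.integrable_add)
  show "AE \<omega> in M. norm (Z \<omega> ^ n) \<le> norm (fact n / t ^ n * (exp (t * Z \<omega>) + exp (- t * Z \<omega>)))"
  proof (rule AE_I2)
    fix \<omega>
    have "(t * \<bar>Z \<omega>\<bar>) ^ n / fact n \<le> exp (t * \<bar>Z \<omega>\<bar>)"
      using sum_le_suminf[OF sums_summable[OF exp_converges], of "{n}" "t * \<bar>Z \<omega>\<bar>"]
        sums_unique[OF exp_converges[of "t * \<bar>Z \<omega>\<bar>"]] \<open>t > 0\<close>
      by (simp add: field_simps)
    also have "\<dots> \<le> exp (t * Z \<omega>) + exp (- t * Z \<omega>)"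
      by (cases "Z \<omega> \<ge> 0") auto
    finally have "\<bar>Z \<omega>\<bar> ^ n \<le> fact n / t ^ n * (exp (t * Z \<omega>) + exp (- t * Z \<omega>))"
      using \<open>t > 0\<close> by (simp add: field_simps power_mult_distrib)
    then show "norm (Z \<omega> ^ n) \<le> norm (fact n / t ^ n * (exp (t * Z \<omega>) + exp (- t * Z \<omega>)))"
      using \<open>t > 0\<close> by (simp add: power_abs)
  qed
qed simp

text \<open>The exponential series may be integrated term by term: the partial sums of absolute
  values stay below \<open>exp (t * Z) + exp (- t * Z)\<close>, so their integrals are bounded and
  \<open>sums_integral\<close> applies.\<close>

lemma mgf_sums:
  fixes Z :: "'a \<Rightarrow> real"
  assumes [measurable]: "Z \<in> borel_measurable M"
    and Zn: "\<And>n. integrable M (\<lambda>\<omega>. Z \<omega> ^ n)"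
    and e: "integrable M (\<lambda>\<omega>. exp (t * Z \<omega>))" "integrable M (\<lambda>\<omega>. exp (- t * Z \<omega>))"
  shows "(\<lambda>n. fps_nth (moment_fps M Z) n * t ^ n) sums integral\<^sup>L M (\<lambda>\<omega>. exp (t * Z \<omega>))"
proof -
  define f where "f n \<omega> = (t * Z \<omega>) ^ n / fact n" for n \<omega>
  have exp_sums: "(\<lambda>n. x ^ n / fact n) sums exp x" for x :: real
    using exp_converges[of x] by (simp add: field_simps)
  have f_sums: "(\<lambda>n. f n \<omega>) sums exp (t * Z \<omega>)" for \<omega>
    unfolding f_def by (rule exp_sums)
  have abs_f_sums: "(\<lambda>n. norm (f n \<omega>)) sums exp \<bar>t * Z \<omega>\<bar>" for \<omega>
    using exp_sums[of "\<bar>t * Z \<omega>\<bar>"] by (simp add: f_def power_abs)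
  have f_int: "integrable M (f n)" for n
    using integrable_mult_right[OF Zn[of n], of "t ^ n / fact n"]
    by (simp add: f_def[abs_def] power_mult_distrib)
  have f_le: "(\<Sum>i<n. norm (f i \<omega>)) \<le> exp (t * Z \<omega>) + exp (- t * Z \<omega>)" for n \<omega>
  proof -
    have "(\<Sum>i<n. norm (f i \<omega>)) \<le> exp \<bar>t * Z \<omega>\<bar>"
      using abs_f_sums[of \<omega>] by (metis norm_ge_zero sum_le_suminf sums_iff finite_lessThan)
    also have "\<dots> \<le> exp (t * Z \<omega>) + exp (- t * Z \<omega>)"
      by (cases "t * Z \<omega> \<ge> 0") auto
    finally show ?thesis .
  qed
  have "summable (\<lambda>n. \<integral>\<omega>. norm (f n \<omega>) \<partial>M)"
  proof (rule summableI_nonneg_bounded)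
    show "(\<Sum>i<n. \<integral>\<omega>. norm (f i \<omega>) \<partial>M) \<le> (\<integral>\<omega>. exp (t * Z \<omega>) + exp (- t * Z \<omega>) \<partial>M)" for n
    proof -
      have "(\<Sum>i<n. \<integral>\<omega>. norm (f i \<omega>) \<partial>M) = (\<integral>\<omega>. (\<Sum>i<n. norm (f i \<omega>)) \<partial>M)"
        using f_int by (intro Bochner_Integration.integral_sum[symmetric] integrable_norm)
      also have "\<dots> \<le> (\<integral>\<omega>. exp (t * Z \<omega>) + exp (- t * Z \<omega>) \<partial>M)"
        using f_int e f_le
        by (intro integral_mono Bochner_Integration.integrable_sum integrable_norm
            Bochner_Integration.integrable_add)
      finally show ?thesis .
    qed
  qed simp
  moreover have "AE \<omega> in M. summable (\<lambda>n. norm (f n \<omega>))"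
    using abs_f_sums by (auto simp: sums_iff)
  ultimately have "(\<lambda>n. integral\<^sup>L M (f n)) sums (\<integral>\<omega>. (\<Sum>n. f n \<omega>) \<partial>M)"
    using f_int by (intro sums_integral)
  moreover have "(\<lambda>\<omega>. \<Sum>n. f n \<omega>) = (\<lambda>\<omega>. exp (t * Z \<omega>))"
    using f_sums by (auto simp: sums_iff)
  moreover have "integral\<^sup>L M (f n) = fps_nth (moment_fps M Z) n * t ^ n" for n
    by (simp add: f_def[abs_def] moment_fps_def power_mult_distrib)
  ultimately show ?thesis
    by simp
qed

text \<open>The scale \<open>c\<close> allows both expectations of the defining identity to be
  treated at once, with \<open>c = 1/2\<close> and \<open>c = -1/2\<close>.\<close>

lemma mgf_has_fps_expansion:
  fixes Z :: "'a \<Rightarrow> real"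
  assumes [measurable]: "Z \<in> borel_measurable M" and "r > 0"
    and mgf: "\<And>t. \<bar>t\<bar> < r \<Longrightarrow> integrable M (\<lambda>\<omega>. exp (t * Z \<omega>))"
  shows "(\<lambda>t. integral\<^sup>L M (\<lambda>\<omega>. exp (c * t * Z \<omega>)))
    has_fps_expansion fps_compose (moment_fps M Z) (fps_const c * fps_X)"
proof (rule has_fps_expansionI)
  have Zn: "integrable M (\<lambda>\<omega>. Z \<omega> ^ n)" for n
    using \<open>r > 0\<close> mgf[of "r/2"] mgf[of "- (r/2)"]
    by (intro integrable_power_of_integrable_exp[where t = "r/2"]) auto
  \<comment> \<open>By continuity \<open>c * t\<close> lies within radius \<open>r\<close> for
    \<open>t\<close> near 0, where both exponentials needed by \<open>mgf_sums\<close> are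
    integrable. No division by \<open>c\<close> occurs, so \<open>c = 0\<close> is covered as
    well.\<close>
  have "((\<lambda>t. \<bar>c * t\<bar>) \<longlongrightarrow> \<bar>c * 0\<bar>) (nhds 0)"
    by (intro tendsto_intros filterlim_ident)
  then have "eventually (\<lambda>t. \<bar>c * t\<bar> < r) (nhds 0)"
    using \<open>r > 0\<close> by (intro order_tendstoD) auto
  then show "eventually (\<lambda>t. (\<lambda>n. fps_nth (fps_compose (moment_fps M Z) (fps_const c * fps_X)) n * t ^ n)
      sums integral\<^sup>L M (\<lambda>\<omega>. exp (c * t * Z \<omega>))) (nhds 0)"
  proof eventually_elim
    case (elim t)
    then show ?case
      using mgf_sums[OF _ Zn, of "c * t"] mgf[of "c * t"] mgf[of "- (c * t)"]
      unfolding fps_nth_compose_linear by (simp add: power_mult_distrib mult_ac)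
  qed
qed

section \<open>Moments of sums of independent variables\<close>

context prob_space
begin

lemma moment_fps_zero: "moment_fps M (\<lambda>_. 0) = 1"
  by (rule fps_ext) (simp add: moment_fps_def power_0_left prob_space)

text \<open>Independence factorises each expectation in the binomial expansion of
  \<open>(U + V) ^ n\<close>. After division by \<open>fact n\<close> the binomial convolution of
  moments is the Cauchy product of the two exponential series.\<close>

lemma indep_var_add_power:
  fixes U V :: "'a \<Rightarrow> real"
  assumes indep: "indep_var borel U borel V"
    and U: "\<And>n. integrable M (\<lambda>\<omega>. U \<omega> ^ n)" and V: "\<And>n. integrable M (\<lambda>\<omega>. V \<omega> ^ n)"
  shows integrable_indep_add_power: "integrable M (\<lambda>\<omega>. (U \<omega> + V \<omega>) ^ n)"
    and moment_fps_indep_add: "moment_fps M (\<lambda>\<omega>. U \<omega> + V \<omega>) = moment_fps M U * moment_fps M V"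
proof -
  have "indep_var borel (\<lambda>\<omega>. U \<omega> ^ i) borel (\<lambda>\<omega>. V \<omega> ^ j)" for i j
    using indep_var_compose[OF indep, of "\<lambda>x. x ^ i" borel "\<lambda>x. x ^ j" borel]
    by (simp add: comp_def)
  note UV = indep_var_integrable[OF this U V] indep_var_lebesgue_integral[OF this U V]
  have eq: "(U \<omega> + V \<omega>) ^ n = (\<Sum>i\<le>n. of_nat (n choose i) * (U \<omega> ^ i * V \<omega> ^ (n - i)))" for n \<omega>
    by (simp add: binomial_ring mult_ac)
  show "integrable M (\<lambda>\<omega>. (U \<omega> + V \<omega>) ^ n)" for n
    unfolding eq using UV(1) by (intro Bochner_Integration.integrable_sum integrable_mult_right)
  show "moment_fps M (\<lambda>\<omega>. U \<omega> + V \<omega>) = moment_fps M U * moment_fps M V"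
  proof (rule fps_ext)
    fix n
    have "fps_nth (moment_fps M (\<lambda>\<omega>. U \<omega> + V \<omega>)) n =
        (\<Sum>i\<le>n. of_nat (n choose i) * (expectation (\<lambda>\<omega>. U \<omega> ^ i) * expectation (\<lambda>\<omega>. V \<omega> ^ (n - i)))) / fact n"
      unfolding moment_fps_def fps_nth_Abs_fps eq using UV
      by (subst Bochner_Integration.integral_sum) (simp_all add: UV)
    also have "\<dots> = fps_nth (moment_fps M U * moment_fps M V) n"
      unfolding fps_mult_nth moment_fps_def atLeast0AtMost sum_divide_distrib
      by (intro sum.cong refl) (simp add: binomial_fact)
    finally show "fps_nth (moment_fps M (\<lambda>\<omega>. U \<omega> + V \<omega>)) n =
      fps_nth (moment_fps M U * moment_fps M V) n" .
  qed
qed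

text \<open>Integrability is part of the induction claim because adding one more variable requires
  all moments of the sum so far.\<close>

lemma indep_vars_sum_power:
  fixes X :: "'i \<Rightarrow> 'a \<Rightarrow> real"
  assumes "finite I" "indep_vars (\<lambda>_. borel) X I"
    and "\<And>i n. i \<in> I \<Longrightarrow> integrable M (\<lambda>\<omega>. X i \<omega> ^ n)"
  shows "(\<forall>n. integrable M (\<lambda>\<omega>. (\<Sum>i\<in>I. X i \<omega>) ^ n)) \<and>
    moment_fps M (\<lambda>\<omega>. \<Sum>i\<in>I. X i \<omega>) = (\<Prod>i\<in>I. moment_fps M (X i))"
  using assms
proof (induction I rule: finite_induct)
  case empty
  then show ?case
    by (simp add: moment_fps_zero)
next
  case (insert i I)
  have IH: "\<And>n. integrable M (\<lambda>\<omega>. (\<Sum>i\<in>I. X i \<omega>) ^ n)"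
    "moment_fps M (\<lambda>\<omega>. \<Sum>i\<in>I. X i \<omega>) = (\<Prod>i\<in>I. moment_fps M (X i))"
    using insert.IH indep_vars_subset[OF insert.prems(1)] insert.prems(2) by blast+
  note indep = indep_vars_sum[OF insert.hyps insert.prems(1)]
  show ?case
    using integrable_indep_add_power[OF indep insert.prems(2) IH(1)]
      moment_fps_indep_add[OF indep insert.prems(2) IH(1)] IH(2) insert.hyps
    by simp
qed

end

section \<open>Extracting the coefficients from the defining identity\<close>

lemma prob_central_factorial_eq_fps_nth:
  assumes exp1: "(\<lambda>t. integral\<^sup>L M (\<lambda>\<omega>. exp (Y \<omega> / 2 * t))) has_fps_expansion A"
    and exp2: "(\<lambda>t. integral\<^sup>L M (\<lambda>\<omega>. exp (- (Y \<omega> / 2) * t))) has_fps_expansion B"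
    and "fps_nth A 0 = fps_nth B 0"
  shows "prob_central_factorial M Y n k = fact n / fact k * fps_nth ((A - B) ^ k) n"
proof -
  define F where "F k t = 1 / fact k *
    (integral\<^sup>L M (\<lambda>\<omega>. exp (Y \<omega> / 2 * t)) - integral\<^sup>L M (\<lambda>\<omega>. exp (- (Y \<omega> / 2) * t))) ^ k" for k t
  define T where "T n k = fact n / fact k * fps_nth ((A - B) ^ k) n" for n k
  define Q where "Q T' \<longleftrightarrow> (\<forall>k. F k has_fps_expansion Abs_fps (\<lambda>n. if k \<le> n then T' n k / fact n else 0)) \<and>
    (\<forall>n k. n < k \<longrightarrow> T' n k = 0)" for T' :: "nat \<Rightarrow> nat \<Rightarrow> real"
  \<comment> \<open>Equal constant terms leave \<open>A - B\<close> without one, so its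
    \<open>k\<close>-th power starts at degree \<open>k\<close> or later. Thus the series cut off
    below \<open>k\<close> is the full expansion, and the zero convention holds.\<close>
  have T0: "T n k = 0" if "n < k" for n k
    using startsby_zero_power_prefix[of "A - B" k] that assms(3) by (simp add: T_def)
  have F_exp: "F k has_fps_expansion Abs_fps (\<lambda>n. if k \<le> n then T n k / fact n else 0)" for k
  proof -
    \<comment> \<open>The power is written as a product of \<open>k\<close> equal factors so that
      \<open>has_fps_expansion_prod\<close> applies.\<close>
    have "F k has_fps_expansion fps_const (1 / fact k) * (\<Prod>i<k. A - B)"
      using has_fps_expansion_cmult_left[OF has_fps_expansion_prod[OF has_fps_expansion_diff[OF exp1 exp2]],
        of "1 / fact k" "{..<k}"]
      by (simp add: F_def[abs_def])
    moreover have "fps_const (1 / fact k) * (\<Prod>i<k. A - B) =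
        Abs_fps (\<lambda>n. if k \<le> n then T n k / fact n else 0)"
    proof (rule fps_ext)
      show "fps_nth (fps_const (1 / fact k) * (\<Prod>i<k. A - B)) n =
          fps_nth (Abs_fps (\<lambda>n. if k \<le> n then T n k / fact n else 0)) n" for n
        using T0[of n k] by (auto simp: T_def)
    qed
    ultimately show ?thesis
      by simp
  qed
  have "prob_central_factorial M Y = The Q"
    unfolding prob_central_factorial_def Q_def F_def by simp
  also have "The Q = T"
  proof (rule the_equality)
    show "Q T"
      using F_exp T0 by (simp add: Q_def)
  next
    fix T' assume "Q T'"
    have "T' n k = T n k" for n k
    \<comment> \<open>The series determines only the values with \<open>k \<le> n\<close>; the
      others agree by the zero convention.\<close>
    proof (cases "k \<le> n")
      case True
      have "Abs_fps (\<lambda>n. if k \<le> n then T' n k / fact n else 0) =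
          Abs_fps (\<lambda>n. if k \<le> n then T n k / fact n else 0)"
        using \<open>Q T'\<close> F_exp[of k] by (auto simp: Q_def intro: has_fps_expansion_unique)
      from arg_cong[OF this, of "\<lambda>H. fps_nth H n"] True show ?thesis
        by simp
    qed (use \<open>Q T'\<close> T0 in \<open>auto simp: Q_def\<close>)
    then show "T' = T"
      by blast
  qed
  finally show ?thesis
    by (simp add: T_def)
qed

text \<open>The factor \<open>2 ^ n\<close> cancels the powers of 1/2 produced by the two
  rescalings. The sign combines \<open>(-1) ^ j\<close> from the binomial theorem with
  \<open>(-1) ^ (n - l)\<close> from the argument \<open>-1/2\<close>.\<close>

lemma fps_nth_scaled_diff_power:
  fixes P :: "real fps"
  shows "2 ^ n * fps_nth ((fps_compose P (fps_const (1/2) * fps_X) - fps_compose P (fps_const (-1/2) * fps_X)) ^ k) n =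
    (\<Sum>j=0..k. \<Sum>l=0..n. real (k choose j) * (-1) powi (int n - int l - int j) *
      fps_nth (P ^ (k - j)) l * fps_nth (P ^ j) (n - l))"
proof -
  define h where "h c = fps_compose P (fps_const c * fps_X)" for c
  \<comment> \<open>Composition commutes with powers, and substituting \<open>c\<close> times the
    variable multiplies the coefficient of degree \<open>l\<close> by \<open>c ^ l\<close>.\<close>
  have h_power: "fps_nth (h c ^ j) l = c ^ l * fps_nth (P ^ j) l" for c j l
    unfolding h_def using fps_compose_power[of "fps_const c * fps_X" P j]
    by (metis fps_nth_compose_linear fps_mult_fps_X_commute fps_X_mult_nth mult.commute)
  \<comment> \<open>The exponent \<open>n - l - j\<close> can be negative, hence the integer power;
    for base -1 the inverse of \<open>(-1) ^ j\<close> is \<open>(-1) ^ j\<close> itself.\<close>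
  have sign: "(-1) ^ j * 2 ^ n * ((1/2) ^ l * (-1/2) ^ (n - l)) = ((-1) powi (int n - int l - int j) :: real)"
    if "l \<le> n" for j l
  proof -
    have "(-1) powi (int n - int l - int j) = ((-1) ^ (n - l) * (-1) ^ j :: real)"
      using that by (simp add: power_int_diff flip: of_nat_diff) (simp add: divide_simps flip: power_mult_distrib)
    moreover have "(2::real) ^ n = 2 ^ l * 2 ^ (n - l)"
      using that by (simp flip: power_add)
    moreover have "(-1/2 :: real) ^ (n - l) = (-1) ^ (n - l) / 2 ^ (n - l)"
      by (rule power_divide)
    ultimately show ?thesis
      by (simp add: power_divide)
  qed
  \<comment> \<open>With the negative summand first, \<open>binomial_ring\<close> gives it the
    exponent \<open>j\<close>, leaving \<open>k - j\<close> for \<open>h (1/2)\<close> as in the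
    target formula.\<close>
  have "(h (1/2) - h (-1/2)) ^ k = (- h (-1/2) + h (1/2)) ^ k"
    by simp
  also have "\<dots> = (\<Sum>j\<le>k. of_nat (k choose j) * (- h (-1/2)) ^ j * h (1/2) ^ (k - j))"
    by (rule binomial_ring)
  also have "\<dots> = (\<Sum>j\<le>k. fps_const (real (k choose j) * (-1) ^ j) * (h (1/2) ^ (k - j) * h (-1/2) ^ j))"
    by (intro sum.cong refl, subst power_minus) (simp add: fps_of_nat[symmetric] mult_ac flip: fps_const_mult fps_const_power fps_const_neg)
  finally have binomial: "(h (1/2) - h (-1/2)) ^ k =
      (\<Sum>j\<le>k. fps_const (real (k choose j) * (-1) ^ j) * (h (1/2) ^ (k - j) * h (-1/2) ^ j))" .
  have "2 ^ n * fps_nth ((h (1/2) - h (-1/2)) ^ k) n =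
      (\<Sum>j=0..k. \<Sum>l=0..n. real (k choose j) * ((-1) ^ j * 2 ^ n * ((1/2) ^ l * (-1/2) ^ (n - l))) *
        fps_nth (P ^ (k - j)) l * fps_nth (P ^ j) (n - l))"
    unfolding binomial fps_sum_nth fps_mult_left_const_nth fps_mult_nth[of "h (1/2) ^ _"] h_power
      sum_distrib_left
    by (simp add: mult_ac atLeast0AtMost)
  also have "\<dots> = (\<Sum>j=0..k. \<Sum>l=0..n. real (k choose j) * (-1) powi (int n - int l - int j) *
      fps_nth (P ^ (k - j)) l * fps_nth (P ^ j) (n - l))"
    by (intro sum.cong refl, subst sign) auto
  finally show ?thesis
    by (simp add: h_def)
qed

section \<open>The formula for the probabilistic central factorial numbers\<close>

theorem theorem2p1:
  fixes M :: "'a measure" and Y :: "'a \<Rightarrow> real" and X :: "nat \<Rightarrow> 'a \<Rightarrow> real"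
    and r :: real and n k :: nat
  assumes "prob_space M"
    and "Y \<in> borel_measurable M"
    and "r > 0"
    and "\<And>t. \<bar>t\<bar> < r \<Longrightarrow> integrable M (\<lambda>\<omega>. exp (t * Y \<omega>))"
    and "prob_space.indep_vars M (\<lambda>_. borel) X {1..}"
    and "\<And>j. j \<ge> 1 \<Longrightarrow> distr M borel (X j) = distr M borel Y"
    and "k \<le> n"
  shows "2 ^ n * prob_central_factorial M Y n k =
    1 / fact k * (\<Sum>j=0..k. \<Sum>l=0..n.
      real (n choose l) * real (k choose j) * (-1) powi (int n - int l - int j) *
      integral\<^sup>L M (\<lambda>\<omega>. partial_sum X (k - j) \<omega> ^ l) *
      integral\<^sup>L M (\<lambda>\<omega>. partial_sum X j \<omega> ^ (n - l)))"
proof -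
  interpret prob_space M
    by fact
  note [measurable] = assms(2)
  define P where "P = moment_fps M Y"
  have Y_power: "integrable M (\<lambda>\<omega>. Y \<omega> ^ m)" for m
    using assms(3) assms(4)[of "r/2"] assms(4)[of "- (r/2)"]
    by (intro integrable_power_of_integrable_exp[where t = "r/2"]) auto
  have X_meas [measurable]: "X j \<in> borel_measurable M" if "j \<ge> 1" for j
    using assms(5) that by (auto simp: indep_vars_def)
  \<comment> \<open>Moments depend only on the law, so they are transferred from \<open>Y\<close> to
    \<open>X j\<close> through the common distribution.\<close>
  have X_power: "integrable M (\<lambda>\<omega>. X j \<omega> ^ m)"
    and X_moment: "expectation (\<lambda>\<omega>. X j \<omega> ^ m) = expectation (\<lambda>\<omega>. Y \<omega> ^ m)" if "j \<ge> 1" for j m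
    using Y_power[of m] assms(6)[OF that] X_meas[OF that]
      integrable_distr_eq[of "X j" M borel "\<lambda>x. x ^ m"] integrable_distr_eq[of Y M borel "\<lambda>x. x ^ m"]
      integral_distr[of "X j" M borel "\<lambda>x. x ^ m"] integral_distr[of Y M borel "\<lambda>x. x ^ m"]
    by simp_all
  \<comment> \<open>For \<open>j = 0\<close> the empty sum is 0 and \<open>P ^ 0 = 1\<close>, in
    agreement with the convention that the zeroth partial sum vanishes.\<close>
  have sum_moment: "expectation (\<lambda>\<omega>. partial_sum X j \<omega> ^ m) = fact m * fps_nth (P ^ j) m" for j m
  proof -
    have "moment_fps M (partial_sum X j) = (\<Prod>i=1..j. moment_fps M (X i))"
      using indep_vars_sum_power[of "{1..j}" X] indep_vars_subset[OF assms(5), of "{1..j}"] X_power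
      by (auto simp: partial_sum_def[abs_def])
    also have "\<dots> = (\<Prod>i=1..j. P)"
      by (intro prod.cong) (simp_all add: P_def moment_fps_def X_moment)
    finally have "moment_fps M (partial_sum X j) = P ^ j"
      by simp
    then show ?thesis
      by (simp flip: \<open>moment_fps M (partial_sum X j) = P ^ j\<close> add: moment_fps_def)
  qed
  have "prob_central_factorial M Y n k = fact n / fact k *
    fps_nth ((fps_compose P (fps_const (1/2) * fps_X) - fps_compose P (fps_const (-1/2) * fps_X)) ^ k) n"
    using mgf_has_fps_expansion[OF assms(2-4), of "1/2"] mgf_has_fps_expansion[OF assms(2-4), of "-1/2"]
    by (intro prob_central_factorial_eq_fps_nth) (simp_all add: P_def mult_ac)
  then have "2 ^ n * prob_central_factorial M Y n k = fact n / fact k *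
    (2 ^ n * fps_nth ((fps_compose P (fps_const (1/2) * fps_X) - fps_compose P (fps_const (-1/2) * fps_X)) ^ k) n)"
    by simp
  also have "\<dots> = 1 / fact k * (\<Sum>j=0..k. \<Sum>l=0..n. real (k choose j) * (-1) powi (int n - int l - int j) *
      fact n * fps_nth (P ^ (k - j)) l * fps_nth (P ^ j) (n - l))"
    unfolding fps_nth_scaled_diff_power by (simp add: sum_distrib_left mult_ac)
  also have "\<dots> = 1 / fact k * (\<Sum>j=0..k. \<Sum>l=0..n.
      real (n choose l) * real (k choose j) * (-1) powi (int n - int l - int j) *
      expectation (\<lambda>\<omega>. partial_sum X (k - j) \<omega> ^ l) *
      expectation (\<lambda>\<omega>. partial_sum X j \<omega> ^ (n - l)))"
    \<comment> \<open>The factor \<open>fact n\<close> splits as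
      \<open>(n choose l) * fact l * fact (n - l)\<close>, and the two factorials turn the
      coefficients into moments.\<close>
    by (intro arg_cong[where f = "\<lambda>x. 1 / fact k * x"] sum.cong refl) (simp add: sum_moment binomial_fact)
  finally show ?thesis .
qed

end
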